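(* Let $n\ge 4$ be an integer. For every $r=(r_1,\ldots,r_n)$ with $0<r_i<\pi$ for all $i$ and $r\neq(\tfrac{\pi}{2},\ldots,\tfrac{\pi}{2})$, one has $$V^{\mathbb{S}^3}(r)<V^{\mathbb{S}^3}\left(\tfrac{\pi}{2},\ldots,\tfrac{\pi}{2}\right).$$ That is, among all spherical $n$-gons, the regular one with side-length $\pi/2$ is the unique most flexible one.
   Context: An $n$-gon in $\mathbb{S}^3$ (unit 3-sphere) is given by vertices $(v_1,\ldots,v_n)$ joined in cyclic order by geodesic segments $e_i$ from $v_i$ to $v_{i+1}$ (indices mod $n$). Its side-lengths are $r_i=\mathrm{length}(e_i)$, assumed to satisfy $0<r_i<\pi$. It is regular if all its side-lengths are equal. The moduli space of polygons with side-lengths $r=(r_1,\ldots,r_n)$ is the space of all such polygons modulo $SO(4)$. The flexibility of a polygon with side-lengths $r$ is measured by the symplectic volume $V^{\mathbb{S}^3}(r)$ of this moduli space, so larger volume means more flexible. An empty moduli space has volume $0$. The moduli space is identified with $$\{(g_1,\ldots,g_n)\in SU(2)^n : g_1\cdots g_n=\mathrm{Id},\ \mathrm{Tr}(g_j)=2\cos r_j\ \forall j\}/SU(2)$$ (diagonal conjugation). This is the moduli space of flat $SU(2)$ connections on the $n$-punctured sphere with holonomy around the $j$-th puncture conjugate to $\mathrm{diag}(e^{ir_j},e^{-ir_j})$, and it carries the Atiyah-Bott symplectic structure. The volume is normalized so that it is given by Witten's formula (a known result, which may be taken as the definition of $V^{\mathbb{S}^3}$): $$V^{\mathbb{S}^3}(r)=\frac{2^{n-1}}{\pi}\sum_{k=1}^\infty\frac{\sin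 kr_1\cdots\sin kr_n}{k^{n-2}}.$$ *)

theory Defs
  imports "HOL-Analysis.Analysis"
begin

(* Symplectic volume of the moduli space of n-gons in the unit 3-sphere with side-lengths
   r 1, ..., r n (values of r outside {1..n} are irrelevant), defined by Witten's formula

     2^(n-1) / pi * sum_{k >= 1} sin (k * r 1) ... sin (k * r n) / k^(n-2).

   The summation index of suminf starts at 0, so k is Suc j below.  The definition is meant
   for n >= 4, where the series converges absolutely (lemma summable_polygon_volume_S3). *)
definition polygon_volume_S3 :: "nat \<Rightarrow> (nat \<Rightarrow> real) \<Rightarrow> real" where
  "polygon_volume_S3 n r =
     2 ^ (n - 1) / pi *
       (\<Sum>j. (\<Prod>i\<in>{1..n}. sin (real (Suc j) * r i)) / real (Suc j) ^ (n - 2))"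

lemma summable_polygon_volume_S3:
  fixes n :: nat and r :: "nat \<Rightarrow> real"
  assumes "n \<ge> 4"
  shows "summable (\<lambda>j. (\<Prod>i\<in>{1..n}. sin (real (Suc j) * r i)) / real (Suc j) ^ (n - 2))"
proof (rule summable_comparison_test)
  have "summable (\<lambda>k. inverse (real k ^ (n - 2)))"
    using assms by (intro inverse_power_summable) auto
  then show "summable (\<lambda>j. inverse (real (Suc j) ^ (n - 2)))"
    by (simp only: summable_Suc_iff [of "\<lambda>k. inverse (real k ^ (n - 2))"])
  have "\<bar>\<Prod>i\<in>{1..n}. sin (real (Suc j) * r i)\<bar> \<le> 1" for j
    unfolding abs_prod by (intro prod_le_1) auto
  then show "\<exists>N. \<forall>j\<ge>N. norm ((\<Prod>i\<in>{1..n}. sin (real (Suc j) * r i)) / real (Suc j) ^ (n - 2))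
      \<le> inverse (real (Suc j) ^ (n - 2))"
    by (auto simp: abs_divide inverse_eq_divide simp del: of_nat_Suc intro!: divide_right_mono)
qed

end

theory Submission
  imports Defs "HOL-Library.Multiset"
begin

text \<open>
  Cutting a polygon along a diagonal that separates two adjacent sides \<open>a\<close>, \<open>b\<close> from the rest \<open>R\<close>
  gives \<open>V (a, b, R) = \<integral> V (s, R) ds\<close>, the diagonal \<open>s\<close> ranging over all lengths for which the
  spherical triangle with sides \<open>a\<close>, \<open>b\<close>, \<open>s\<close> exists.  This range is all of \<open>[0, \<pi>]\<close> when
  \<open>a = b = \<pi>/2\<close>, and \<open>V \<ge> 0\<close>, so replacing two sides by \<open>\<pi>/2\<close> never decreases the volume.  As \<open>V\<close> is
  symmetric, all sides but one can be replaced in this way; keeping for the end a side different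
  from \<open>\<pi>/2\<close>, the last replacement is strict because \<open>V (s, \<pi>/2, \<dots>, \<pi>/2) > 0\<close> for \<open>0 < s < \<pi>\<close>.
  The induction starts at \<open>n = 4\<close>, where the Fourier series of \<open>\<Sum> cos (k x) / k\<^sup>2\<close> shows that \<open>V\<close> is the
  length of the intersection of the two ranges of a diagonal.
\<close>

subsection \<open>The Fourier series of the second Bernoulli polynomial\<close>

text \<open>Abel's method: on the circles of radius \<open>\<rho> < 1\<close> the derivative of \<open>Re dilog\<close> along the circle
  is bounded, since it is the argument of \<open>1 - \<rho> e\<^sup>i\<^sup>t\<close>, which permits passing to the limit \<open>\<rho> \<rightarrow> 1\<close>.\<close>

lemma Ln_one_minus_cis:
  assumes "0 < t" "t < 2 * pi"
  shows "Ln (1 - cis t) = Complex (ln (2 * sin (t / 2))) ((t - pi) / 2)"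
proof -
  have s: "0 < sin (t / 2)"
    using assms by (intro sin_gt_zero) auto
  have "1 - cis t = of_real (2 * sin (t / 2)) * cis ((t - pi) / 2)"
  proof -
    have "cos t = 1 - 2 * (sin (t / 2))\<^sup>2" "sin t = 2 * sin (t / 2) * cos (t / 2)"
      using cos_double_sin[of "t / 2"] sin_double[of "t / 2"] by auto
    moreover have "cos ((t - pi) / 2) = sin (t / 2)" "sin ((t - pi) / 2) = - cos (t / 2)"
      by (simp_all add: diff_divide_distrib cos_diff sin_diff)
    ultimately show ?thesis
      by (simp add: complex_eq_iff power2_eq_square)
  qed
  also have "\<dots> = exp (Complex (ln (2 * sin (t / 2))) ((t - pi) / 2))"
    using s by (simp add: exp_eq_polar)
  finally show ?thesis
    using assms by (simp add: Ln_exp)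
qed

text \<open>The term k = 0 vanishes because 1 / 0 = 0, so this is the usual dilogarithm.\<close>

definition dilog :: "complex \<Rightarrow> complex" where
  "dilog z = (\<Sum>k. (1 / (of_nat k)\<^sup>2) * z ^ k)"

lemma norm_dilog_term_le:
  assumes "norm (z :: complex) \<le> 1"
  shows "norm ((1 / (of_nat k)\<^sup>2) * z ^ k) \<le> 1 / (real k)\<^sup>2"
  using assms power_le_one[of "norm z" k]
  by (simp add: norm_mult norm_divide norm_power divide_right_mono)

lemma summable_inverse_squares: "summable (\<lambda>k. 1 / (real k)\<^sup>2)"
  using inverse_power_summable[of 2, where 'a = real] by (simp add: inverse_eq_divide)

lemma summable_dilog:
  assumes "norm z \<le> 1"
  shows "summable (\<lambda>k. (1 / (of_nat k)\<^sup>2) * z ^ k :: complex)"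
  by (rule summable_comparison_test'[OF summable_inverse_squares norm_dilog_term_le[OF assms]])

lemma continuous_on_dilog: "continuous_on (cball 0 1) dilog"
proof (rule uniform_limit_theorem)
  show "uniform_limit (cball 0 1) (\<lambda>n z. \<Sum>k<n. (1 / (of_nat k)\<^sup>2) * z ^ k) dilog sequentially"
    unfolding dilog_def
    by (rule Weierstrass_m_test[OF norm_dilog_term_le summable_inverse_squares]) auto
  show "\<forall>\<^sub>F n in sequentially. continuous_on (cball 0 1) (\<lambda>z::complex. \<Sum>k<n. (1 / (of_nat k)\<^sup>2) * z ^ k)"
    by (intro always_eventually allI continuous_on_sum continuous_on_mult continuous_on_const
        continuous_on_power continuous_on_id)
qed simp

text \<open>Termwise differentiation. The product \<open>z * D\<close> avoids dividing by z, and it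
  is what the chain rule produces along a circle, where the velocity is
  \<open>\<i> * z\<close>.\<close>

lemma dilog_deriv:
  assumes "norm z < 1"
  obtains D where "(dilog has_field_derivative D) (at z)" "z * D = - Ln (1 - z)"
proof
  let ?c = "\<lambda>k. 1 / (of_nat k)\<^sup>2 :: complex"
  let ?D = "\<Sum>k. diffs ?c k * z ^ k"
  show "(dilog has_field_derivative ?D) (at z)"
    unfolding dilog_def
    by (rule termdiffs_strong[where K = 1]) (use assms summable_dilog[of 1] in auto)
  have d: "diffs ?c k = 1 / of_nat (Suc k)" for k
    by (simp add: diffs_def power2_eq_square del: of_nat_Suc)
  have "(\<lambda>k. z ^ k / of_nat k) sums - Ln (1 - z)"
    using sums_minus[OF Ln_series'[of "- z"]] assms by simp
  then have "(\<lambda>k. z ^ Suc k / of_nat (Suc k)) sums - Ln (1 - z)"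
    by (subst sums_Suc_iff) simp
  moreover have "summable (\<lambda>k. diffs ?c k * z ^ k)"
    by (rule termdiff_converges[where K = 1]) (use assms summable_dilog in auto)
  then have "(\<lambda>k. z * (diffs ?c k * z ^ k)) sums (z * ?D)"
    by (intro sums_mult summable_sums)
  ultimately show "z * ?D = - Ln (1 - z)"
    by (intro sums_unique2[of "\<lambda>k. z * (diffs ?c k * z ^ k)"]) (simp_all add: d)
qed

lemma has_integral_Im_Ln_circle:
  assumes "0 < \<rho>" "\<rho> < 1" "a \<le> b"
  shows "((\<lambda>t. Im (Ln (1 - of_real \<rho> * cis t))) has_integral
    (Re (dilog (of_real \<rho> * cis b)) - Re (dilog (of_real \<rho> * cis a)))) {a..b}"
proof (rule fundamental_theorem_of_calculus[OF \<open>a \<le> b\<close>])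
  fix t
  let ?z = "of_real \<rho> * cis t"
  obtain D where D: "(dilog has_field_derivative D) (at ?z)" "?z * D = - Ln (1 - ?z)"
    using dilog_deriv[of ?z] assms by (auto simp: norm_mult)
  have "((\<lambda>t. of_real \<rho> * cis t) has_vector_derivative (\<i> * ?z)) (at t within {a..b})"
    unfolding has_vector_derivative_def
    by (auto intro!: derivative_eq_intros simp: scaleR_conv_of_real mult_ac)
  then have "((\<lambda>t. dilog (of_real \<rho> * cis t)) has_vector_derivative (\<i> * ?z * D)) (at t within {a..b})"
    using field_vector_diff_chain_within[of "\<lambda>t. of_real \<rho> * cis t" "\<i> * ?z" t "{a..b}" dilog D]
      has_field_derivative_at_within[OF D(1)]
    by (simp add: o_def)
  moreover have "Re (\<i> * ?z * D) = Im (Ln (1 - ?z))"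
    using D(2) by (simp add: mult.assoc)
  ultimately show "((\<lambda>t. Re (dilog (of_real \<rho> * cis t))) has_vector_derivative Im (Ln (1 - ?z)))
      (at t within {a..b})"
    unfolding has_vector_derivative_def
    by (auto simp only: scaleR_complex.sel real_scaleR_def dest: has_derivative_Re)
qed

lemma Re_dilog_cis_diff:
  assumes "0 < a" "a \<le> b" "b < 2 * pi"
  shows "Re (dilog (cis b)) - Re (dilog (cis a)) = (b\<^sup>2 / 4 - pi * b / 2) - (a\<^sup>2 / 4 - pi * a / 2)"
proof -
  define \<rho> where "\<rho> n = 1 - 1 / real (n + 2)" for n
  have \<rho>: "0 < \<rho> n" "\<rho> n < 1" for n
    by (auto simp: \<rho>_def)
  have lim: "\<rho> \<longlonglongrightarrow> 1"
    unfolding \<rho>_def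
    using tendsto_diff[OF tendsto_const LIMSEQ_ignore_initial_segment[OF lim_1_over_n[where 'a = real], of 2]]
    by simp
  have dil: "(\<lambda>n. Re (dilog (of_real (\<rho> n) * cis x))) \<longlonglongrightarrow> Re (dilog (cis x))" for x
  proof -
    have "(\<lambda>n. of_real (\<rho> n) * cis x) \<longlonglongrightarrow> of_real 1 * cis x"
      by (intro tendsto_intros lim)
    then have "(\<lambda>n. dilog (of_real (\<rho> n) * cis x)) \<longlonglongrightarrow> dilog (of_real 1 * cis x)"
      using \<rho> by (intro continuous_on_tendsto_compose[OF continuous_on_dilog])
        (auto simp: norm_mult less_imp_le)
    then show ?thesis
      by (auto intro: tendsto_Re)
  qed
  have "((\<lambda>t. (t - pi) / 2) has_integral Re (dilog (cis b)) - Re (dilog (cis a))) {a..b}"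
  proof (rule has_integral_dominated_convergence)
    show "((\<lambda>t. Im (Ln (1 - of_real (\<rho> n) * cis t))) has_integral
      (Re (dilog (of_real (\<rho> n) * cis b)) - Re (dilog (of_real (\<rho> n) * cis a)))) {a..b}" for n
      using \<rho> assms by (intro has_integral_Im_Ln_circle)
    show "(\<lambda>_. pi) integrable_on {a..b}"
      by (rule integrable_const_ivl)
    \<comment> \<open>The domination is uniform in the radius because a principal argument never
      exceeds pi in absolute value.\<close>
    show "\<forall>t\<in>{a..b}. norm (Im (Ln (1 - of_real (\<rho> n) * cis t))) \<le> pi" for n
    proof
      fix t
      have "norm (of_real (\<rho> n) * cis t) < 1"
        using \<rho>[of n] by (simp add: norm_mult)
      then have "1 - of_real (\<rho> n) * cis t \<noteq> 0"
        by auto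
      then show "norm (Im (Ln (1 - of_real (\<rho> n) * cis t))) \<le> pi"
        using mpi_less_Im_Ln[of "1 - of_real (\<rho> n) * cis t"] Im_Ln_le_pi[of "1 - of_real (\<rho> n) * cis t"]
        by (simp add: abs_le_iff)
    qed
    show "\<forall>t\<in>{a..b}. (\<lambda>n. Im (Ln (1 - of_real (\<rho> n) * cis t))) \<longlonglongrightarrow> (t - pi) / 2"
    proof
      fix t assume "t \<in> {a..b}"
      then have t: "0 < t" "t < 2 * pi"
        using assms by auto
      \<comment> \<open>Away from the angles 0 and 2 pi, 1 - cis t has positive real part, so it
        stays off the branch cut and Ln is continuous there.\<close>
      have "0 < (sin (t / 2))\<^sup>2"
        using t by (intro zero_less_power sin_gt_zero) auto
      then have "cos t < 1"
        using cos_double_sin[of "t / 2"] by simp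
      then have "1 - cis t \<notin> \<real>\<^sub>\<le>\<^sub>0"
        by (auto simp: complex_nonpos_Reals_iff)
      then have "(\<lambda>n. Im (Ln (1 - of_real (\<rho> n) * cis t))) \<longlonglongrightarrow> Im (Ln (1 - of_real 1 * cis t))"
        by (intro tendsto_intros lim) auto
      then show "(\<lambda>n. Im (Ln (1 - of_real (\<rho> n) * cis t))) \<longlonglongrightarrow> (t - pi) / 2"
        using Ln_one_minus_cis[OF t] by simp
    qed
    show "(\<lambda>n. Re (dilog (of_real (\<rho> n) * cis b)) - Re (dilog (of_real (\<rho> n) * cis a)))
        \<longlonglongrightarrow> Re (dilog (cis b)) - Re (dilog (cis a))"
      by (intro tendsto_intros dil)
  qed
  moreover have "((\<lambda>t. (t - pi) / 2) has_integral
      ((b\<^sup>2 / 4 - pi * b / 2) - (a\<^sup>2 / 4 - pi * a / 2))) {a..b}"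
  proof (rule fundamental_theorem_of_calculus[OF \<open>a \<le> b\<close>])
    fix t
    show "((\<lambda>t. t\<^sup>2 / 4 - pi * t / 2) has_vector_derivative (t - pi) / 2) (at t within {a..b})"
      by (auto intro!: derivative_eq_intros simp: field_simps
        simp flip: has_real_derivative_iff_has_vector_derivative)
  qed
  ultimately show ?thesis
    by (rule has_integral_unique)
qed

text \<open>The difference \<open>h\<close> of the two sides, up to a constant, is constant on the
  open interval by the preceding lemma, hence on the closed one by continuity. Its value is read off
  at 0 from the Basel sum.\<close>

lemma Re_dilog_cis:
  assumes "0 \<le> x" "x \<le> 2 * pi"
  shows "Re (dilog (cis x)) = pi\<^sup>2 / 6 - pi * x / 2 + x\<^sup>2 / 4"
proof -
  define h where "h x = Re (dilog (cis x)) - (x\<^sup>2 / 4 - pi * x / 2)" for x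
  have "continuous_on UNIV h"
    unfolding h_def by (intro continuous_intros continuous_on_compose2[OF continuous_on_dilog]) auto
  then have cont: "continuous_on (closure {0<..<2 * pi}) h"
    by (rule continuous_on_subset) auto
  have const: "h x = h pi" if "x \<in> {0<..<2 * pi}" for x
    using that Re_dilog_cis_diff[of x pi] Re_dilog_cis_diff[of pi x]
    by (cases "x \<le> pi") (auto simp: h_def)
  have *: "h x = h pi" if "x \<in> {0..2 * pi}" for x
    using continuous_constant_on_closure[OF cont const, of x] that by simp
  have "(\<lambda>k. 1 / (of_nat k)\<^sup>2) sums (pi\<^sup>2 / 6 :: real)"
    using inverse_squares_sums sums_Suc_iff[of "\<lambda>k. 1 / (real k)\<^sup>2" "pi\<^sup>2 / 6"] by (simp add: add.commute)
  then have "(\<lambda>k. of_real (1 / (of_nat k)\<^sup>2) * 1 ^ k) sums (of_real (pi\<^sup>2 / 6) :: complex)"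
    by (simp only: power_one mult_1_right sums_of_real_iff)
  then have "dilog 1 = of_real (pi\<^sup>2 / 6)"
    unfolding dilog_def by (simp add: sums_iff)
  then have "Re (dilog 1) = pi\<^sup>2 / 6"
    by (simp only: Re_complex_of_real)
  then have "h 0 = pi\<^sup>2 / 6"
    by (simp add: h_def)
  with *[of 0] *[of x] assms show ?thesis
    by (simp add: h_def)
qed

lemma cos_over_squares_sums:
  assumes "\<bar>x\<bar> \<le> 2 * pi"
  shows "(\<lambda>j. cos (real (Suc j) * x) / (real (Suc j))\<^sup>2) sums (pi\<^sup>2 / 6 - pi * \<bar>x\<bar> / 2 + x\<^sup>2 / 4)"
proof -
  have "(\<lambda>k. (1 / (of_nat k)\<^sup>2) * cis \<bar>x\<bar> ^ k) sums dilog (cis \<bar>x\<bar>)"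
    unfolding dilog_def by (intro summable_sums summable_dilog) simp
  then have "(\<lambda>k. Re ((1 / (of_nat k)\<^sup>2) * cis \<bar>x\<bar> ^ k)) sums Re (dilog (cis \<bar>x\<bar>))"
    by (rule sums_Re)
  moreover have "Re ((1 / (of_nat k)\<^sup>2) * cis \<bar>x\<bar> ^ k) = cos (real k * x) / (real k)\<^sup>2" for k
  proof -
    have "Re ((1 / (of_nat k)\<^sup>2) * cis \<bar>x\<bar> ^ k) = Re (of_real (1 / (real k)\<^sup>2) * cis (real k * \<bar>x\<bar>))"
      by (simp add: Complex.DeMoivre)
    also have "\<dots> = cos \<bar>real k * x\<bar> / (real k)\<^sup>2"
      by (simp add: abs_mult)
    finally show ?thesis
      by simp
  qed
  ultimately have "(\<lambda>k. cos (real k * x) / (real k)\<^sup>2) sums (pi\<^sup>2 / 6 - pi * \<bar>x\<bar> / 2 + x\<^sup>2 / 4)"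
    using assms by (simp only: Re_dilog_cis abs_ge_zero power2_abs)
  then show ?thesis
    by (subst sums_Suc_iff) simp
qed

subsection \<open>Cutting off two sides\<close>

text \<open>With a multiset of sides the symmetry of the volume is built in, and sides can be split
  off or replaced without reindexing.\<close>

definition witten_volume :: "real multiset \<Rightarrow> real" where
  "witten_volume M = 2 ^ (size M - 1) / pi *
     (\<Sum>j. (\<Prod>x\<in>#M. sin (real (Suc j) * x)) / real (Suc j) ^ (size M - 2))"

lemma summable_inverse_power_Suc:
  assumes "2 \<le> m"
  shows "summable (\<lambda>j. 1 / real (Suc j) ^ m)"
  using summable_Suc_iff[of "\<lambda>k. inverse (real k ^ m)"] inverse_power_summable[OF assms, where 'a = real]
  by (simp add: inverse_eq_divide del: of_nat_Suc)

lemma abs_prod_sin_le_1: "\<bar>\<Prod>x\<in>#M. sin (c * x :: real)\<bar> \<le> 1"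
proof (induction M)
  case (add x M)
  then show ?case
    using mult_mono[OF abs_sin_le_one[of "c * x"] add] by (simp add: abs_mult)
qed simp

lemma witten_term_le:
  "norm ((\<Prod>x\<in>#M. sin (real (Suc j) * x)) / real (Suc j) ^ m) \<le> 1 / real (Suc j) ^ m"
  using abs_prod_sin_le_1[of "real (Suc j)" M] by (simp add: divide_right_mono del: of_nat_Suc)

lemma witten_volume_sums:
  assumes "4 \<le> size M"
  shows "(\<lambda>j. 2 ^ (size M - 1) / pi *
      ((\<Prod>x\<in>#M. sin (real (Suc j) * x)) / real (Suc j) ^ (size M - 2))) sums witten_volume M"
  unfolding witten_volume_def
  using assms by (intro sums_mult summable_sums
      summable_comparison_test'[OF summable_inverse_power_Suc witten_term_le]) auto

text \<open>The range of the third side of a spherical triangle with two sides \<open>a\<close> and \<open>b\<close>.\<close>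

definition third_lo :: "real \<Rightarrow> real \<Rightarrow> real" where
  "third_lo a b = \<bar>a - b\<bar>"

text \<open>This is the smaller of a + b and 2 pi - a - b: the triangle inequality together with the
  bound 2 pi on the perimeter.\<close>

definition third_hi :: "real \<Rightarrow> real \<Rightarrow> real" where
  "third_hi a b = pi - \<bar>a + b - pi\<bar>"

lemma third_side_bounds:
  assumes "a \<in> {0..pi}" "b \<in> {0..pi}"
  shows "0 \<le> third_lo a b" "third_lo a b \<le> third_hi a b" "third_hi a b \<le> pi"
  using assms by (auto simp: third_lo_def third_hi_def abs_if)

lemma third_side_pi_half: "third_lo (pi / 2) (pi / 2) = 0" "third_hi (pi / 2) (pi / 2) = pi"
  by (simp_all add: third_lo_def third_hi_def)

text \<open>The product formula gives cosines at a - b and a + b. For integer k the reflections x to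
  -x and x to 2 pi - x preserve cos (k x), so these arguments may be moved to the ends of the
  diagonal's range.\<close>

lemma two_sin_mult_sin:
  "2 * (sin (real k * a) * sin (real k * b)) = cos (real k * third_lo a b) - cos (real k * third_hi a b)"
proof -
  have per: "cos (real k * (2 * pi - x)) = cos (real k * x)" for x
    using cos_npi[of "2 * k"] sin_npi[of "2 * k"]
    by (simp add: right_diff_distrib cos_diff mult_ac)
  have "cos (real k * third_lo a b) = cos (real k * (a - b))"
    by (cases "a \<le> b") (simp_all add: third_lo_def right_diff_distrib cos_diff)
  moreover have "cos (real k * third_hi a b) = cos (real k * (a + b))"
    using per[of "a + b"] by (cases "a + b \<le> pi") (simp_all add: third_hi_def algebra_simps)
  ultimately show ?thesis
    by (simp add: right_diff_distrib distrib_left cos_diff cos_add)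
qed

text \<open>The quadratic parts of the Fourier sums cancel; the linear parts combine through
  \<open>u + v + \<bar>u - v\<bar> = 2 * max u v\<close>.\<close>

lemma witten_volume_quadrilateral:
  assumes "a \<in> {0..pi}" "b \<in> {0..pi}" "c \<in> {0..pi}" "d \<in> {0..pi}"
  shows "witten_volume {#a, b, c, d#} = max 0 (min (third_hi a b) (third_hi c d) - max (third_lo a b) (third_lo c d))"
proof -
  define \<alpha> \<beta> \<gamma> \<delta> where "\<alpha> = third_lo a b" "\<beta> = third_hi a b" "\<gamma> = third_lo c d" "\<delta> = third_hi c d"
  note defs = this
  have bounds: "0 \<le> \<alpha>" "\<alpha> \<le> \<beta>" "\<beta> \<le> pi" "0 \<le> \<gamma>" "\<gamma> \<le> \<delta>" "\<delta> \<le> pi"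
    using assms third_side_bounds by (auto simp: defs)
  define B where "B x = pi\<^sup>2 / 6 - pi * \<bar>x\<bar> / 2 + x\<^sup>2 / 4" for x
  define C where "C j x = cos (real (Suc j) * x) / (real (Suc j))\<^sup>2" for j x
  \<comment> \<open>The signs come from expanding 2 (cos k\<alpha> - cos k\<beta>) (cos k\<gamma> -
    cos k\<delta>) into cosines of sums and differences. All arguments lie in [-2 pi, 2 pi], where
    the Fourier sum is known.\<close>
  define F where "F g = g (\<alpha> + \<gamma>) + g (\<alpha> - \<gamma>) - g (\<alpha> + \<delta>) - g (\<alpha> - \<delta>)
      - g (\<beta> + \<gamma>) - g (\<beta> - \<gamma>) + g (\<beta> + \<delta>) + g (\<beta> - \<delta>)" for g :: "real \<Rightarrow> real"
  have "(\<lambda>j. F (C j)) sums F B"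
    unfolding F_def C_def B_def using bounds
    by (intro sums_add sums_diff cos_over_squares_sums) auto
  then have "(\<lambda>j. 1 / pi * F (C j)) sums (1 / pi * F B)"
    by (rule sums_mult)
  moreover have "1 / pi * F (C j) = 2 ^ 3 / pi *
      ((\<Prod>x\<in>#{#a, b, c, d#}. sin (real (Suc j) * x)) / (real (Suc j))\<^sup>2)" for j
  proof -
    let ?k = "real (Suc j)"
    have "F (C j) = 2 * (cos (?k * \<alpha>) - cos (?k * \<beta>)) * (cos (?k * \<gamma>) - cos (?k * \<delta>)) / ?k\<^sup>2"
      unfolding F_def C_def
      by (simp add: distrib_left right_diff_distrib cos_add cos_diff add_divide_distrib
          diff_divide_distrib left_diff_distrib del: of_nat_Suc)
    also have "\<dots> = 2 * (2 * (sin (?k * a) * sin (?k * b))) * (2 * (sin (?k * c) * sin (?k * d))) / ?k\<^sup>2"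
      by (simp only: two_sin_mult_sin defs)
    finally show ?thesis
      by (simp add: mult_ac del: of_nat_Suc)
  qed
  ultimately have "witten_volume {#a, b, c, d#} = 1 / pi * F B"
    using witten_volume_sums[of "{#a, b, c, d#}"]
    by (simp add: sums_iff eval_nat_numeral del: of_nat_Suc power_Suc prod_mset.insert)
  also have "F B = pi * (max \<alpha> \<delta> + max \<beta> \<gamma> - max \<alpha> \<gamma> - max \<beta> \<delta>)"
  proof -
    have B: "B (u + v) + B (u - v) = pi\<^sup>2 / 3 - pi * max u v + (u\<^sup>2 + v\<^sup>2) / 2"
      if "0 \<le> u" "0 \<le> v" for u v
      using that by (cases "u \<le> v") (simp_all add: B_def power2_eq_square field_simps)
    have "F B = (B (\<alpha> + \<gamma>) + B (\<alpha> - \<gamma>)) - (B (\<alpha> + \<delta>) + B (\<alpha> - \<delta>))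
      - (B (\<beta> + \<gamma>) + B (\<beta> - \<gamma>)) + (B (\<beta> + \<delta>) + B (\<beta> - \<delta>))"
      by (simp add: F_def)
    then show ?thesis
      using B[of \<alpha> \<gamma>] B[of \<alpha> \<delta>] B[of \<beta> \<gamma>] B[of \<beta> \<delta>] bounds
      unfolding right_diff_distrib distrib_left add_divide_distrib by linarith
  qed
  \<comment> \<open>The right-hand side is the length of the intersection of [\<alpha>, \<beta>] and
    [\<gamma>, \<delta>], with 0 for disjoint intervals.\<close>
  also have "max \<alpha> \<delta> + max \<beta> \<gamma> - max \<alpha> \<gamma> - max \<beta> \<delta> = max 0 (min \<beta> \<delta> - max \<alpha> \<gamma>)"
    using bounds by (auto simp: max_def min_def)
  finally show ?thesis
    by (simp add: defs)
qed

section \<open>Integration of the volume over the diagonal\<close>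

lemma continuous_on_witten_volume:
  assumes "3 \<le> size R"
  shows "continuous_on S (\<lambda>s. witten_volume (add_mset s R))"
proof -
  have "uniform_limit S
      (\<lambda>N s. \<Sum>j<N. (\<Prod>x\<in>#add_mset s R. sin (real (Suc j) * x)) / real (Suc j) ^ (size R - 1))
      (\<lambda>s. \<Sum>j. (\<Prod>x\<in>#add_mset s R. sin (real (Suc j) * x)) / real (Suc j) ^ (size R - 1)) sequentially"
    by (rule Weierstrass_m_test[OF witten_term_le summable_inverse_power_Suc]) (use assms in auto)
  then have "continuous_on S
      (\<lambda>s. \<Sum>j. (\<Prod>x\<in>#add_mset s R. sin (real (Suc j) * x)) / real (Suc j) ^ (size R - 1))"
    by (rule uniform_limit_theorem[rotated])
      (auto intro!: always_eventually continuous_intros simp del: of_nat_Suc)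
  then show ?thesis
    unfolding witten_volume_def by (intro continuous_intros) (simp_all add: numeral_2_eq_2 del: of_nat_Suc)
qed

text \<open>Integrating sin (k s) over the range of the diagonal gives 2 sin (k a) sin (k b) / k.
  The extra factors 2 and 1 / k are exactly those of Witten's formula for one more side. At least
  three sides in \<open>R\<close> make the exponent \<open>size R - 1\<close> at least 2, so the
  series may be integrated termwise.\<close>

lemma has_integral_witten_volume:
  assumes "3 \<le> size R" "a \<in> {0..pi}" "b \<in> {0..pi}"
  shows "((\<lambda>s. witten_volume (add_mset s R)) has_integral witten_volume (add_mset a (add_mset b R)))
    {third_lo a b..third_hi a b}"
proof -
  let ?P = "\<lambda>j. \<Prod>x\<in>#R. sin (real (Suc j) * x)"
  let ?C = "2 ^ size R / pi"
  let ?f = "\<lambda>j s. ?C * (sin (real (Suc j) * s) * ?P j / real (Suc j) ^ (size R - 1))"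
  let ?g = "\<lambda>j. 2 * ?C * (sin (real (Suc j) * a) * sin (real (Suc j) * b) * ?P j / real (Suc j) ^ size R)"
  have V: "witten_volume (add_mset s R) = (\<Sum>j. ?f j s)" for s
    using witten_volume_sums[of "add_mset s R"] assms by (simp add: sums_iff numeral_2_eq_2 del: of_nat_Suc)
  have bound: "norm (?f j s) \<le> ?C * (1 / real (Suc j) ^ (size R - 1))" for j s
    using mult_left_mono[OF witten_term_le[of j "add_mset s R" "size R - 1"], of ?C]
    by (simp add: abs_mult del: of_nat_Suc)
  have lim: "uniform_limit {third_lo a b..third_hi a b} (\<lambda>N s. \<Sum>j<N. ?f j s) (\<lambda>s. witten_volume (add_mset s R)) sequentially"
    unfolding V
    by (rule Weierstrass_m_test[OF bound]) (intro summable_mult summable_inverse_power_Suc, use assms in auto)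
  have "continuous_on {third_lo a b..third_hi a b} (\<lambda>s. \<Sum>j<N. ?f j s)" for N
    by (intro continuous_intros) auto
  then obtain I J where I: "\<And>N. ((\<lambda>s. \<Sum>j<N. ?f j s) has_integral I N) {third_lo a b..third_hi a b}"
    and J: "((\<lambda>s. witten_volume (add_mset s R)) has_integral J) {third_lo a b..third_hi a b}" "I \<longlonglongrightarrow> J"
    using uniform_limit_integral[OF lim] by auto
  have "(?f j has_integral ?g j) {third_lo a b..third_hi a b}" for j
  proof -
    let ?k = "real (Suc j)"
    have "((\<lambda>s. sin (?k * s)) has_integral (- cos (?k * third_hi a b) / ?k - - cos (?k * third_lo a b) / ?k)) {third_lo a b..third_hi a b}"
    proof (rule fundamental_theorem_of_calculus)
      fix s
      show "((\<lambda>s. - cos (?k * s) / ?k) has_vector_derivative sin (?k * s)) (at s within {third_lo a b..third_hi a b})"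
        by (auto intro!: derivative_eq_intros simp del: of_nat_Suc
            simp flip: has_real_derivative_iff_has_vector_derivative)
    qed (use assms third_side_bounds in auto)
    moreover have "- cos (?k * third_hi a b) / ?k - - cos (?k * third_lo a b) / ?k
        = 2 * (sin (?k * a) * sin (?k * b)) / ?k"
      unfolding two_sin_mult_sin by (simp add: diff_divide_distrib del: of_nat_Suc)
    ultimately have "((\<lambda>s. ?C * (?P j / ?k ^ (size R - 1)) * sin (?k * s)) has_integral
        ?C * (?P j / ?k ^ (size R - 1)) * (2 * (sin (?k * a) * sin (?k * b)) / ?k)) {third_lo a b..third_hi a b}"
      by (intro has_integral_mult_right) simp
    moreover have "?k ^ size R = ?k ^ (size R - 1) * ?k"
      using assms by (simp flip: power_Suc2 del: of_nat_Suc)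
    ultimately show ?thesis
      by (simp add: mult_ac del: of_nat_Suc)
  qed
  \<comment> \<open>The limit theorem only supplies some integrals \<open>I\<close>; uniqueness
    identifies them with the partial sums of \<open>?g\<close>.\<close>
  then have "I = (\<lambda>N. \<Sum>j<N. ?g j)"
    by (intro ext has_integral_unique[OF I] has_integral_sum) auto
  then have "?g sums J"
    using J(2) by (simp only: sums_def)
  moreover have "?g sums witten_volume (add_mset a (add_mset b R))"
    using witten_volume_sums[of "add_mset a (add_mset b R)"] assms by (simp add: mult_ac del: of_nat_Suc)
  ultimately show ?thesis
    using J(1) sums_unique2 by blast
qed


subsection \<open>Replacing sides by a quarter circle\<close>

lemma size_ge_2_obtain:
  assumes "2 \<le> size M"
  obtains a b R where "M = add_mset a (add_mset b R)"
proof -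
  from assms obtain a M' where M: "M = add_mset a M'"
    by (cases M) auto
  with assms obtain b R where "M' = add_mset b R"
    by (cases M') auto
  with M that show ?thesis
    by blast
qed

lemma witten_volume_nonneg:
  assumes "4 \<le> size M" "set_mset M \<subseteq> {0..pi}"
  shows "0 \<le> witten_volume M"
  using assms
proof (induction M rule: measure_induct_rule[where f = size])
  case (less M)
  obtain a b R where M: "M = add_mset a (add_mset b R)"
    using size_ge_2_obtain[of M] less.prems(1) by auto
  show ?case
  proof (cases "size R = 2")
    case True
    then obtain c d R' where "R = add_mset c (add_mset d R')"
      using size_ge_2_obtain[of R] by auto
    with True M have "M = {#a, b, c, d#}"
      by simp
    with less.prems show ?thesis
      by (simp add: witten_volume_quadrilateral)
  next
    case False
    with M less.prems(1) have R: "3 \<le> size R"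
      by simp
    have "0 \<le> witten_volume (add_mset s R)" if "s \<in> {third_lo a b..third_hi a b}" for s
      using less.IH[of "add_mset s R"] less.prems R M that third_side_bounds[of a b] by simp
    then show ?thesis
      using has_integral_nonneg[OF has_integral_witten_volume[of R a b]] M R less.prems by simp
  qed
qed

text \<open>Two quarter circles enlarge the diagonal's range to [0, pi]. This enlarges one of the
  two intersected intervals for a quadrilateral, and the domain of a nonnegative integrand
  otherwise.\<close>

lemma witten_volume_pair_le:
  assumes "2 \<le> size R" "set_mset R \<subseteq> {0..pi}" "a \<in> {0..pi}" "b \<in> {0..pi}"
  shows "witten_volume (add_mset a (add_mset b R)) \<le> witten_volume (add_mset (pi / 2) (add_mset (pi / 2) R))"
proof (cases "size R = 2")
  case True
  then obtain c d R' where "R = add_mset c (add_mset d R')"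
    using size_ge_2_obtain[of R] by auto
  with True have "R = {#c, d#}"
    by simp
  with assms third_side_bounds[of a b] third_side_bounds[of c d] show ?thesis
    by (auto simp: witten_volume_quadrilateral third_side_pi_half)
next
  case False
  with assms have R: "3 \<le> size R"
    by simp
  show ?thesis
  proof (rule has_integral_subset_le[OF _ has_integral_witten_volume has_integral_witten_volume])
    show "{third_lo a b..third_hi a b} \<subseteq> {third_lo (pi / 2) (pi / 2)..third_hi (pi / 2) (pi / 2)}"
      using third_side_bounds[of a b] assms by (auto simp: third_side_pi_half)
    show "\<forall>s\<in>{third_lo (pi / 2) (pi / 2)..third_hi (pi / 2) (pi / 2)}. 0 \<le> witten_volume (add_mset s R)"
      using R assms by (auto simp: third_side_pi_half intro!: witten_volume_nonneg)
  qed (use R assms in auto)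
qed

section \<open>Positivity and the strict last replacement\<close>

lemma third_side_bounds_strict:
  assumes "0 < b" "b < pi"
  shows "0 \<le> third_lo (pi / 2) b" "third_lo (pi / 2) b < third_hi (pi / 2) b" "third_hi (pi / 2) b \<le> pi"
  using assms by (auto simp: third_lo_def third_hi_def abs_if)

lemma witten_volume_replicate_pos:
  assumes "3 \<le> m" "0 < s" "s < pi"
  shows "0 < witten_volume (add_mset s (replicate_mset m (pi / 2)))"
  using assms
proof (induction m arbitrary: s rule: dec_induct)
  case base
  \<comment> \<open>Pairing s with one quarter circle leaves two others, whose range is all of
    [0, pi]; the volume is then the positive length of the range for s.\<close>
  then have "witten_volume {#pi / 2, s, pi / 2, pi / 2#} > 0"
    using third_side_bounds_strict[of s]
    by (subst witten_volume_quadrilateral) (auto simp: third_side_pi_half)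
  then show ?case
    by (simp add: eval_nat_numeral add_mset_commute)
next
  case (step m)
  let ?R = "replicate_mset m (pi / 2)" and ?l = "third_lo (pi / 2) s" and ?h = "third_hi (pi / 2) s"
  note b = third_side_bounds_strict[OF step.prems]
  \<comment> \<open>Positivity of the integrand is needed only in the open interval: for s = pi/2
    the endpoints are 0 and pi, which the induction hypothesis does not cover.\<close>
  have "integral {?l..?h} (\<lambda>_. 0) < integral {?l..?h} (\<lambda>t. witten_volume (add_mset t ?R))"
    using b step by (intro integral_less_real continuous_on_witten_volume) auto
  then show ?case
    using has_integral_witten_volume[of ?R "pi / 2" s] step
    by (simp add: integral_unique add_mset_commute)
qed

lemma witten_volume_replicate_less:
  assumes "3 \<le> m" "0 < x" "x < pi" "x \<noteq> pi / 2"
  shows "witten_volume (add_mset x (replicate_mset m (pi / 2))) < witten_volume (replicate_mset (Suc m) (pi / 2))"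
proof (cases "m = 3")
  case True
  \<comment> \<open>By the length formula the left side is pi - 2 |x - pi/2| and the right side is
    pi.\<close>
  have "witten_volume {#pi / 2, x, pi / 2, pi / 2#} < witten_volume {#pi / 2, pi / 2, pi / 2, pi / 2#}"
    using assms by (simp add: witten_volume_quadrilateral third_side_pi_half) (auto simp: third_lo_def third_hi_def)
  with True show ?thesis
    by (simp add: eval_nat_numeral add_mset_commute)
next
  case False
  with assms obtain k where m: "m = Suc k" "3 \<le> k"
    by (cases m) auto
  let ?V = "\<lambda>t. witten_volume (add_mset t (replicate_mset k (pi / 2)))"
    and ?l = "third_lo (pi / 2) x" and ?h = "third_hi (pi / 2) x"
  note b = third_side_bounds_strict[OF assms(2,3)]
  \<comment> \<open>Here x differs from pi/2: the range for x misses [0, \<open>?l\<close>), and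
    this piece contributes a positive amount to the integral over [0, pi].\<close>
  have l: "0 < ?l"
    using assms by (auto simp: third_lo_def)
  have int: "?V integrable_on {u..v}" for u v
    using m by (intro integrable_continuous_real continuous_on_witten_volume) auto
  have nonneg: "0 \<le> ?V t" if "t \<in> {0..pi}" for t
    using that m by (intro witten_volume_nonneg) auto
  have "0 < integral {0..?l} ?V"
  proof -
    have "integral {0..?l} (\<lambda>_. 0) < integral {0..?l} ?V"
      using l b m by (intro integral_less_real continuous_on_witten_volume)
        (auto intro!: witten_volume_replicate_pos)
    then show ?thesis
      by simp
  qed
  moreover have "0 \<le> integral {?h..pi} ?V"
    using b by (intro integral_nonneg int nonneg) auto
  moreover have "integral {0..pi} ?V = integral {0..?l} ?V + integral {?l..?h} ?V + integral {?h..pi} ?V"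
    using b int by (simp add: Henstock_Kurzweil_Integration.integral_combine)
  ultimately have "integral {?l..?h} ?V < integral {0..pi} ?V"
    by simp
  then show ?thesis
    using has_integral_witten_volume[of "replicate_mset k (pi / 2)" "pi / 2" x]
      has_integral_witten_volume[of "replicate_mset k (pi / 2)" "pi / 2" "pi / 2"] m assms
    by (simp add: integral_unique add_mset_commute third_side_pi_half)
qed

section \<open>Replacing all sides but one\<close>

lemma witten_volume_le_replicate:
  assumes "3 \<le> size N" "set_mset N \<subseteq> {0..pi}" "x \<in> {0..pi}"
  shows "witten_volume (add_mset x N) \<le> witten_volume (add_mset x (replicate_mset (size N) (pi / 2)))"
proof -
  \<comment> \<open>The \<open>Suc k\<close> guarantees a quarter circle that can serve as partner
    of the next side b: the pair (pi/2, b) becomes (pi/2, pi/2). Sides are thus replaced singly, x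
    is never touched, and parity does not matter.\<close>
  have *: "witten_volume (add_mset x (replicate_mset (Suc k) (pi / 2) + N'))
      \<le> witten_volume (add_mset x (replicate_mset (Suc k + size N') (pi / 2)))"
    if "2 \<le> k + size N'" "set_mset N' \<subseteq> {0..pi}" for k N'
    using that
  proof (induction N' arbitrary: k)
    case (add b N')
    have "witten_volume (add_mset (pi / 2) (add_mset b (add_mset x (replicate_mset k (pi / 2) + N'))))
        \<le> witten_volume (add_mset (pi / 2) (add_mset (pi / 2) (add_mset x (replicate_mset k (pi / 2) + N'))))"
      using add.prems assms by (intro witten_volume_pair_le) auto
    also have "\<dots> \<le> witten_volume (add_mset x (replicate_mset (Suc (Suc k) + size N') (pi / 2)))"
      using add.IH[of "Suc k"] add.prems by (simp add: add_mset_commute)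
    finally show ?case
      by (simp add: add_mset_commute)
  qed simp
  \<comment> \<open>The first replacement acts on two arbitrary sides and creates the two quarter
    circles from which the induction starts.\<close>
  obtain a b N' where N: "N = add_mset a (add_mset b N')"
    using size_ge_2_obtain[of N] assms(1) by auto
  have "witten_volume (add_mset a (add_mset b (add_mset x N')))
      \<le> witten_volume (add_mset (pi / 2) (add_mset (pi / 2) (add_mset x N')))"
    using assms N by (intro witten_volume_pair_le) auto
  also have "\<dots> \<le> witten_volume (add_mset x (replicate_mset (size N) (pi / 2)))"
    using *[of 1 N'] assms N by (simp add: add_mset_commute)
  finally show ?thesis
    by (simp add: N add_mset_commute)
qed

lemma polygon_volume_S3_eq_witten_volume:
  "polygon_volume_S3 n r = witten_volume (image_mset r (mset_set {1..n}))"
  by (simp add: polygon_volume_S3_def witten_volume_def prod_unfold_prod_mset image_mset.compositionality o_def)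

theorem theorem1p2:
  fixes n :: nat and r :: "nat \<Rightarrow> real"
  assumes "n \<ge> 4"
    and "\<And>i. i \<in> {1..n} \<Longrightarrow> 0 < r i \<and> r i < pi"
    and "\<exists>i\<in>{1..n}. r i \<noteq> pi / 2"
  shows "polygon_volume_S3 n r < polygon_volume_S3 n (\<lambda>_. pi / 2)"
proof -
  obtain i where i: "i \<in> {1..n}" "r i \<noteq> pi / 2"
    using assms(3) by blast
  \<comment> \<open>The side \<open>r i\<close> different from pi/2 is set aside, so that its
    replacement comes last and is strict.\<close>
  define N where "N = image_mset r (mset_set ({1..n} - {i}))"
  have N: "image_mset r (mset_set {1..n}) = add_mset (r i) N"
    unfolding N_def using i(1) mset_set.remove[of "{1..n}" i] by simp
  have size: "size N = n - 1"
    using i by (simp add: N_def)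
  have "set_mset N \<subseteq> {0..pi}"
    using assms(2) by (force simp: N_def)
  then have "witten_volume (add_mset (r i) N) \<le> witten_volume (add_mset (r i) (replicate_mset (n - 1) (pi / 2)))"
    using witten_volume_le_replicate[of N "r i"] assms(1,2) i size by (auto simp: less_imp_le)
  also have "\<dots> < witten_volume (replicate_mset (Suc (n - 1)) (pi / 2))"
    using assms i by (intro witten_volume_replicate_less) auto
  also have "replicate_mset (Suc (n - 1)) (pi / 2) = image_mset (\<lambda>_. pi / 2) (mset_set {1..n})"
    using assms(1) by (simp add: image_mset_const_eq)
  finally show ?thesis
    by (simp only: polygon_volume_S3_eq_witten_volume N)
qed

end
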